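(* Let $\mathcal S$ be a small category, let $\mathcal C$ be a category with a terminal object $1$ and pullbacks, and let $X\colon\mathcal S\to\mathcal C$ be a functor (a categorical dynamical system). Let $\iota\colon\Delta I\Longrightarrow X$ be an invariant subsystem of $X$ equipped with a neighbourhood filter $\mathcal N_X(I)$. Let $L=\{L_s\colon X(s)\to R\}_{s\in\mathcal S}$ be a categorical Lyapunov function for $I$, with Lyapunov measurement datum $(R,0,\{r_\lambda\colon R_\lambda\hookrightarrow R\}_{\lambda\in\Lambda},\le)$. Then the associated sublevel neighbourhoods $$U^\lambda=\bigl(U^\lambda_s\hookrightarrow X(s)\bigr)_{s\in\mathcal S},\qquad U^\lambda_s=X(s)\times_R R_\lambda,\qquad \lambda\in\Lambda,$$ form a Lyapunov basis for $\mathcal N_X(I)$. Consequently, $I$ is Lyapunov stable in $X$ (with respect to $\mathcal N_X(I)$).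
   Context: Constant functor: for $I\in\mathcal C$, $\Delta I\colon\mathcal S\to\mathcal C$ is the functor with value $I$ on every object and $\mathrm{id}_I$ on every morphism. Invariant subsystem: a pair $(I,\iota)$ with $I\in\mathcal C$ and $\iota\colon\Delta I\Longrightarrow X$ a natural transformation all of whose components $\iota_s\colon I\to X(s)$ are monomorphisms. Thus $X(\alpha)\circ\iota_s=\iota_t$ for every $\alpha\colon s\to t$ in $\mathcal S$. Stagewise neighbourhood of $I$ in $X$: a family of monomorphisms $U=(\mu_s\colon U_s\hookrightarrow X(s))_{s\in\mathcal S}$ such that for every $s\in\mathcal S$ the morphism $\iota_s$ factors through $\mu_s$. The collection of these is denoted $\mathsf{Nbd}_X(I)$. For stagewise neighbourhoods $U=(\mu_s\colon U_s\hookrightarrow X(s))_s$ and $V=(\nu_s\colon V_s\hookrightarrow X(s))_s$, write $U\le V$ if for every $s\in\mathcal S$ there is a morphism $\phi_s\colon U_s\to V_s$ with $\nu_s\circ\phi_s=\mu_s$. This is a preorder. Neighbourhood filter of $I$ in $X$: a collection $\mathcal N_X(I)\subseteq\mathsf{Nbd}_X(I)$ such that (1) $\mathcal N_X(I)$ is nonempty; (2) if $U\in\mathcal N_X(I)$, $V\in\mathsf{Nbd}_X(I)$ and $U\le V$, then $V\in\mathcal N_X(I)$; (3) if $U,V\in\mathcal N_X(I)$, then there is $W\in\mathcal N_X(I)$ with $W\le U$ and $W\le V$. Basis: a subcollection $\mathcal B\subseteq\mathcal N_X(I)$ is a basis for $\mathcal N_X(I)$ if for every $U\in\mathcal N_X(I)$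 there is $V\in\mathcal B$ with $V\le U$. Forward-invariant: a stagewise neighbourhood $U=(\mu_s\colon U_s\hookrightarrow X(s))_s$ is forward-invariant if for every morphism $\alpha\colon s\to t$ in $\mathcal S$ the composite $X(\alpha)\circ\mu_s\colon U_s\to X(t)$ factors through $\mu_t\colon U_t\hookrightarrow X(t)$. Lyapunov basis for $\mathcal N_X(I)$: a basis $\mathcal B\subseteq\mathcal N_X(I)$ for $\mathcal N_X(I)$ all of whose members are forward-invariant. Lyapunov stability: $I$ is Lyapunov stable in $X$ if for every $U=(\mu_s\colon U_s\hookrightarrow X(s))_s\in\mathcal N_X(I)$ there exists $V=(\nu_s\colon V_s\hookrightarrow X(s))_s\in\mathcal N_X(I)$ such that $V\le U$ and, for every morphism $\alpha\colon s\to t$ in $\mathcal S$, the composite $X(\alpha)\circ\nu_s\colon V_s\to X(t)$ factors through $\mu_t\colon U_t\hookrightarrow X(t)$. Lyapunov measurement datum in $\mathcal C$: a tuple $\mathfrak R=(R,0,\{r_\lambda\colon R_\lambda\hookrightarrow R\}_{\lambda\in\Lambda},\le)$ consisting of an object $R\in\mathcal C$; a morphism $0\colon 1\to R$; a family of monomorphisms $r_\lambda\colon R_\lambda\hookrightarrow R$ indexed by some $\Lambda$; and, for every object $Y\in\mathcal C$, a preorder $\le$ on $\operatorname{Hom}_{\mathcal C}(Y,R)$, these preorders being preserved by precomposition (if $h\le k\colon Y\to R$ and $f\colon Z\to Y$, then $h\circ f\le k\circ f$). It is required that (i) $0\colon 1\to R$ factors through $r_\lambda$ for every $\lambda\in\Lambda$;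 (ii) for every $\lambda\in\Lambda$ and all $h\le k\colon Y\to R$, if $k$ factors through $r_\lambda$ then $h$ factors through $r_\lambda$. Categorical Lyapunov function for $I$ (where $I$ carries $\mathcal N_X(I)$): a Lyapunov measurement datum $\mathfrak R=(R,0,\{r_\lambda\colon R_\lambda\hookrightarrow R\}_{\lambda\in\Lambda},\le)$ in $\mathcal C$ together with a family of morphisms $L_s\colon X(s)\to R$, $s\in\mathcal S$ (no naturality is required), such that (1) $L_s\circ\iota_s=0\circ{!}_I$ for every $s\in\mathcal S$, where ${!}_I\colon I\to 1$ is the unique morphism; (2) $L_t\circ X(\alpha)\le L_s$ in $\operatorname{Hom}_{\mathcal C}(X(s),R)$ for every morphism $\alpha\colon s\to t$ in $\mathcal S$; (3) the sublevel stagewise neighbourhoods $U^\lambda=(U^\lambda_s\hookrightarrow X(s))_{s\in\mathcal S}$, $\lambda\in\Lambda$, form a basis for $\mathcal N_X(I)$ (in particular they belong to $\mathcal N_X(I)$). Here $U^\lambda_s:=X(s)\times_R R_\lambda$ is the pullback of $r_\lambda$ along $L_s$, and $U^\lambda_s\hookrightarrow X(s)$ is the pullback projection. This projection is a monomorphism, and by (1) and (i) the morphism $\iota_s$ factors through it, so $U^\lambda$ is a stagewise neighbourhood of $I$. *)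

theory Defs
  imports "HOL-Library.FuncSet"
begin

text \<open>
  Object sets and arrow sets are explicit carriers inside types. Composition and the other
  operations are total functions, constrained only where they are meaningful; \<open>Comp C g f\<close>
  is the composite \<open>g \<circ> f\<close>.
\<close>

record ('o, 'a) cat =
  Obj :: "'o set"
  Arr :: "'a set"
  Dom :: "'a \<Rightarrow> 'o"
  Cod :: "'a \<Rightarrow> 'o"
  Ident :: "'o \<Rightarrow> 'a"
  Comp :: "'a \<Rightarrow> 'a \<Rightarrow> 'a"

definition Hom :: "('o, 'a) cat \<Rightarrow> 'o \<Rightarrow> 'o \<Rightarrow> 'a set" where
  "Hom C x y = {f \<in> Arr C. Dom C f = x \<and> Cod C f = y}"

locale category =
  fixes C :: "('o, 'a) cat"
  assumes Dom_closed: "f \<in> Arr C \<Longrightarrow> Dom C f \<in> Obj C"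
    and Cod_closed: "f \<in> Arr C \<Longrightarrow> Cod C f \<in> Obj C"
    and Id_in_Hom: "x \<in> Obj C \<Longrightarrow> Ident C x \<in> Hom C x x"
    and Comp_in_Hom: "f \<in> Hom C x y \<Longrightarrow> g \<in> Hom C y z \<Longrightarrow> Comp C g f \<in> Hom C x z"
    and Comp_Id_right: "f \<in> Hom C x y \<Longrightarrow> Comp C f (Ident C x) = f"
    and Comp_Id_left: "f \<in> Hom C x y \<Longrightarrow> Comp C (Ident C y) f = f"
    and Comp_assoc: "f \<in> Hom C w x \<Longrightarrow> g \<in> Hom C x y \<Longrightarrow> h \<in> Hom C y z \<Longrightarrow>
      Comp C h (Comp C g f) = Comp C (Comp C h g) f"

definition monic :: "('o, 'a) cat \<Rightarrow> 'a \<Rightarrow> bool" where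
  "monic C m \<longleftrightarrow> m \<in> Arr C \<and>
    (\<forall>y\<in>Obj C. \<forall>g\<in>Hom C y (Dom C m). \<forall>h\<in>Hom C y (Dom C m).
      Comp C m g = Comp C m h \<longrightarrow> g = h)"

definition factors_through :: "('o, 'a) cat \<Rightarrow> 'a \<Rightarrow> 'a \<Rightarrow> bool" where
  "factors_through C f m \<longleftrightarrow> (\<exists>h\<in>Hom C (Dom C f) (Dom C m). Comp C m h = f)"

definition terminal :: "('o, 'a) cat \<Rightarrow> 'o \<Rightarrow> bool" where
  "terminal C one \<longleftrightarrow> one \<in> Obj C \<and> (\<forall>y\<in>Obj C. \<exists>!f. f \<in> Hom C y one)"

definition to_terminal :: "('o, 'a) cat \<Rightarrow> 'o \<Rightarrow> 'o \<Rightarrow> 'a" where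
  "to_terminal C one y = (THE f. f \<in> Hom C y one)"

definition is_pullback :: "('o, 'a) cat \<Rightarrow> 'a \<Rightarrow> 'a \<Rightarrow> 'a \<Rightarrow> 'a \<Rightarrow> bool" where
  "is_pullback C f g p q \<longleftrightarrow>
    (\<exists>P\<in>Obj C. p \<in> Hom C P (Dom C f) \<and> q \<in> Hom C P (Dom C g) \<and>
      Comp C f p = Comp C g q \<and>
      (\<forall>Y\<in>Obj C. \<forall>a\<in>Hom C Y (Dom C f). \<forall>b\<in>Hom C Y (Dom C g).
        Comp C f a = Comp C g b \<longrightarrow>
        (\<exists>!u. u \<in> Hom C Y P \<and> Comp C p u = a \<and> Comp C q u = b)))"

text \<open>
  A category with pullbacks is given together with a choice \<open>pb\<close> of a pullback span
  \<open>(p, q)\<close>, with \<open>p\<close> the projection to \<open>Dom C f\<close>, for every cospan \<open>(f, g)\<close>. The choice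
  is an arbitrary parameter.
\<close>

definition pullback_choice :: "('o, 'a) cat \<Rightarrow> ('a \<Rightarrow> 'a \<Rightarrow> 'a \<times> 'a) \<Rightarrow> bool" where
  "pullback_choice C pb \<longleftrightarrow>
    (\<forall>f\<in>Arr C. \<forall>g\<in>Arr C. Cod C f = Cod C g \<longrightarrow>
      is_pullback C f g (fst (pb f g)) (snd (pb f g)))"

lemma pullback_choice_exists_iff:
  "(\<exists>pb. pullback_choice C pb) \<longleftrightarrow>
    (\<forall>f\<in>Arr C. \<forall>g\<in>Arr C. Cod C f = Cod C g \<longrightarrow> (\<exists>p q. is_pullback C f g p q))"
    (is "?lhs \<longleftrightarrow> ?rhs")
proof
  assume ?lhs
  then show ?rhs
    unfolding pullback_choice_def by blast
next
  assume rhs: ?rhs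
  define pb where "pb f g = (SOME pq. is_pullback C f g (fst pq) (snd pq))" for f g
  have "is_pullback C f g (fst (pb f g)) (snd (pb f g))"
    if "f \<in> Arr C" "g \<in> Arr C" "Cod C f = Cod C g" for f g
  proof -
    from rhs that obtain p q where "is_pullback C f g p q"
      by blast
    then have "is_pullback C f g (fst (p, q)) (snd (p, q))"
      by simp
    then show ?thesis
      unfolding pb_def by (rule someI)
  qed
  then show ?lhs
    unfolding pullback_choice_def by blast
qed

record ('s, 'b, 'o, 'a) functor_data =
  ObjMap :: "'s \<Rightarrow> 'o"
  ArrMap :: "'b \<Rightarrow> 'a"

locale cat_functor = S: category S + C: category C
  for S :: "('s, 'b) cat" and C :: "('o, 'a) cat" +
  fixes X :: "('s, 'b, 'o, 'a) functor_data"
  assumes ObjMap_closed: "s \<in> Obj S \<Longrightarrow> ObjMap X s \<in> Obj C"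
    and ArrMap_in_Hom: "\<alpha> \<in> Hom S s t \<Longrightarrow> ArrMap X \<alpha> \<in> Hom C (ObjMap X s) (ObjMap X t)"
    and ArrMap_Id: "s \<in> Obj S \<Longrightarrow> ArrMap X (Ident S s) = Ident C (ObjMap X s)"
    and ArrMap_Comp: "\<alpha> \<in> Hom S s t \<Longrightarrow> \<beta> \<in> Hom S t u \<Longrightarrow>
      ArrMap X (Comp S \<beta> \<alpha>) = Comp C (ArrMap X \<beta>) (ArrMap X \<alpha>)"

definition nat_trans ::
  "('s, 'b) cat \<Rightarrow> ('o, 'a) cat \<Rightarrow> ('s, 'b, 'o, 'a) functor_data \<Rightarrow>
    ('s, 'b, 'o, 'a) functor_data \<Rightarrow> ('s \<Rightarrow> 'a) \<Rightarrow> bool" where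
  "nat_trans S C F G \<eta> \<longleftrightarrow>
    cat_functor S C F \<and> cat_functor S C G \<and>
    (\<forall>s\<in>Obj S. \<eta> s \<in> Hom C (ObjMap F s) (ObjMap G s)) \<and>
    (\<forall>s\<in>Obj S. \<forall>t\<in>Obj S. \<forall>\<alpha>\<in>Hom S s t.
      Comp C (ArrMap G \<alpha>) (\<eta> s) = Comp C (\<eta> t) (ArrMap F \<alpha>))"

definition const_functor :: "('o, 'a) cat \<Rightarrow> 'o \<Rightarrow> ('s, 'b, 'o, 'a) functor_data" where
  "const_functor C I = \<lparr>ObjMap = (\<lambda>s. I), ArrMap = (\<lambda>\<alpha>. Ident C I)\<rparr>"

definition invariant_subsystem ::
  "('s, 'b) cat \<Rightarrow> ('o, 'a) cat \<Rightarrow> ('s, 'b, 'o, 'a) functor_data \<Rightarrow> 'o \<Rightarrow> ('s \<Rightarrow> 'a) \<Rightarrow> bool" where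
  "invariant_subsystem S C X I \<iota> \<longleftrightarrow>
    I \<in> Obj C \<and> nat_trans S C (const_functor C I) X \<iota> \<and> (\<forall>s\<in>Obj S. monic C (\<iota> s))"

text \<open>
  A stagewise neighbourhood is the family of its monomorphisms \<open>\<mu> s\<close>; the object \<open>U\<^sub>s\<close> is
  \<open>Dom C (\<mu> s)\<close>. Families are extensional, i.e. determined by their values on \<open>Obj S\<close>.
\<close>

definition Nbd ::
  "('s, 'b) cat \<Rightarrow> ('o, 'a) cat \<Rightarrow> ('s, 'b, 'o, 'a) functor_data \<Rightarrow> ('s \<Rightarrow> 'a) \<Rightarrow> ('s \<Rightarrow> 'a) set" where
  "Nbd S C X \<iota> =
    {\<mu> \<in> (\<Pi>\<^sub>E s\<in>Obj S. {m. monic C m \<and> Cod C m = ObjMap X s}).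
      \<forall>s\<in>Obj S. factors_through C (\<iota> s) (\<mu> s)}"

definition nbd_le ::
  "('s, 'b) cat \<Rightarrow> ('o, 'a) cat \<Rightarrow> ('s \<Rightarrow> 'a) \<Rightarrow> ('s \<Rightarrow> 'a) \<Rightarrow> bool" where
  "nbd_le S C \<mu> \<nu> \<longleftrightarrow>
    (\<forall>s\<in>Obj S. \<exists>\<phi>\<in>Hom C (Dom C (\<mu> s)) (Dom C (\<nu> s)). Comp C (\<nu> s) \<phi> = \<mu> s)"

definition neighbourhood_filter ::
  "('s, 'b) cat \<Rightarrow> ('o, 'a) cat \<Rightarrow> ('s, 'b, 'o, 'a) functor_data \<Rightarrow> ('s \<Rightarrow> 'a) \<Rightarrow>
    ('s \<Rightarrow> 'a) set \<Rightarrow> bool" where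
  "neighbourhood_filter S C X \<iota> N \<longleftrightarrow>
    N \<subseteq> Nbd S C X \<iota> \<and>
    N \<noteq> {} \<and>
    (\<forall>U\<in>N. \<forall>V\<in>Nbd S C X \<iota>. nbd_le S C U V \<longrightarrow> V \<in> N) \<and>
    (\<forall>U\<in>N. \<forall>V\<in>N. \<exists>W\<in>N. nbd_le S C W U \<and> nbd_le S C W V)"

definition nbd_basis ::
  "('s, 'b) cat \<Rightarrow> ('o, 'a) cat \<Rightarrow> ('s \<Rightarrow> 'a) set \<Rightarrow> ('s \<Rightarrow> 'a) set \<Rightarrow> bool" where
  "nbd_basis S C N B \<longleftrightarrow> B \<subseteq> N \<and> (\<forall>U\<in>N. \<exists>V\<in>B. nbd_le S C V U)"

definition forward_invariant ::
  "('s, 'b) cat \<Rightarrow> ('o, 'a) cat \<Rightarrow> ('s, 'b, 'o, 'a) functor_data \<Rightarrow> ('s \<Rightarrow> 'a) \<Rightarrow> bool" where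
  "forward_invariant S C X \<mu> \<longleftrightarrow>
    (\<forall>s\<in>Obj S. \<forall>t\<in>Obj S. \<forall>\<alpha>\<in>Hom S s t.
      factors_through C (Comp C (ArrMap X \<alpha>) (\<mu> s)) (\<mu> t))"

definition lyapunov_basis ::
  "('s, 'b) cat \<Rightarrow> ('o, 'a) cat \<Rightarrow> ('s, 'b, 'o, 'a) functor_data \<Rightarrow> ('s \<Rightarrow> 'a) set \<Rightarrow>
    ('s \<Rightarrow> 'a) set \<Rightarrow> bool" where
  "lyapunov_basis S C X N B \<longleftrightarrow>
    nbd_basis S C N B \<and> (\<forall>U\<in>B. forward_invariant S C X U)"

definition lyapunov_stable ::
  "('s, 'b) cat \<Rightarrow> ('o, 'a) cat \<Rightarrow> ('s, 'b, 'o, 'a) functor_data \<Rightarrow> ('s \<Rightarrow> 'a) set \<Rightarrow> bool" where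
  "lyapunov_stable S C X N \<longleftrightarrow>
    (\<forall>\<mu>\<in>N. \<exists>\<nu>\<in>N. nbd_le S C \<nu> \<mu> \<and>
      (\<forall>s\<in>Obj S. \<forall>t\<in>Obj S. \<forall>\<alpha>\<in>Hom S s t.
        factors_through C (Comp C (ArrMap X \<alpha>) (\<nu> s)) (\<mu> t)))"

text \<open>
  \<open>(h, k) \<in> meas_le D Y\<close> encodes \<open>h \<le> k\<close> in \<open>Hom C Y (meas_obj D)\<close>.
\<close>

record ('o, 'a, 'l) measurement_datum =
  meas_obj :: 'o
  meas_zero :: 'a
  meas_index :: "'l set"
  meas_mono :: "'l \<Rightarrow> 'a"
  meas_le :: "'o \<Rightarrow> 'a rel"

definition lyapunov_measurement_datum ::
  "('o, 'a) cat \<Rightarrow> 'o \<Rightarrow> ('o, 'a, 'l) measurement_datum \<Rightarrow> bool" where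
  "lyapunov_measurement_datum C one D \<longleftrightarrow>
    meas_obj D \<in> Obj C \<and>
    meas_zero D \<in> Hom C one (meas_obj D) \<and>
    (\<forall>l\<in>meas_index D. monic C (meas_mono D l) \<and> Cod C (meas_mono D l) = meas_obj D) \<and>
    (\<forall>Y\<in>Obj C. preorder_on (Hom C Y (meas_obj D)) (meas_le D Y)) \<and>
    (\<forall>Y\<in>Obj C. \<forall>Z\<in>Obj C. \<forall>h k. \<forall>f\<in>Hom C Z Y.
      (h, k) \<in> meas_le D Y \<longrightarrow> (Comp C h f, Comp C k f) \<in> meas_le D Z) \<and>
    (\<forall>l\<in>meas_index D. factors_through C (meas_zero D) (meas_mono D l)) \<and>
    (\<forall>l\<in>meas_index D. \<forall>Y\<in>Obj C. \<forall>h k. (h, k) \<in> meas_le D Y \<longrightarrow>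
      factors_through C k (meas_mono D l) \<longrightarrow> factors_through C h (meas_mono D l))"

definition sublevel ::
  "('s, 'b) cat \<Rightarrow> ('a \<Rightarrow> 'a \<Rightarrow> 'a \<times> 'a) \<Rightarrow> ('o, 'a, 'l) measurement_datum \<Rightarrow> ('s \<Rightarrow> 'a) \<Rightarrow>
    'l \<Rightarrow> 's \<Rightarrow> 'a" where
  "sublevel S pb D L l = (\<lambda>s\<in>Obj S. fst (pb (L s) (meas_mono D l)))"

definition lyapunov_function ::
  "('s, 'b) cat \<Rightarrow> ('o, 'a) cat \<Rightarrow> 'o \<Rightarrow> ('a \<Rightarrow> 'a \<Rightarrow> 'a \<times> 'a) \<Rightarrow>
    ('s, 'b, 'o, 'a) functor_data \<Rightarrow> 'o \<Rightarrow> ('s \<Rightarrow> 'a) \<Rightarrow> ('s \<Rightarrow> 'a) set \<Rightarrow>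
    ('o, 'a, 'l) measurement_datum \<Rightarrow> ('s \<Rightarrow> 'a) \<Rightarrow> bool" where
  "lyapunov_function S C one pb X I \<iota> N D L \<longleftrightarrow>
    lyapunov_measurement_datum C one D \<and>
    (\<forall>s\<in>Obj S. L s \<in> Hom C (ObjMap X s) (meas_obj D)) \<and>
    (\<forall>s\<in>Obj S. Comp C (L s) (\<iota> s) = Comp C (meas_zero D) (to_terminal C one I)) \<and>
    (\<forall>s\<in>Obj S. \<forall>t\<in>Obj S. \<forall>\<alpha>\<in>Hom S s t.
      (Comp C (L t) (ArrMap X \<alpha>), L s) \<in> meas_le D (ObjMap X s)) \<and>
    nbd_basis S C N (sublevel S pb D L ` meas_index D)"

end

theory Submission
  imports Defs
begin

text \<open>
  A morphism into \<open>X(t)\<close> factors through the sublevel object \<open>U\<^sup>\<lambda>\<^sub>t\<close> iff its composite with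
  \<open>L\<^sub>t\<close> factors through \<open>r\<^sub>\<lambda>\<close>. For the restriction of \<open>X(\<alpha>)\<close> to \<open>U\<^sup>\<lambda>\<^sub>s\<close> this composite is
  below the restriction of \<open>L\<^sub>s\<close>, which factors through \<open>r\<^sub>\<lambda>\<close>; so it factors too, by the
  downward closure of \<open>r\<^sub>\<lambda>\<close>.
\<close>

lemma HomD:
  assumes "f \<in> Hom C x y"
  shows "f \<in> Arr C" "Dom C f = x" "Cod C f = y"
  using assms by (auto simp: Hom_def)

lemma Arr_in_Hom: "f \<in> Arr C \<Longrightarrow> f \<in> Hom C (Dom C f) (Cod C f)"
  by (simp add: Hom_def)

lemma nbd_le_iff_factors_through:
  "nbd_le S C \<mu> \<nu> \<longleftrightarrow> (\<forall>s\<in>Obj S. factors_through C (\<mu> s) (\<nu> s))"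
  by (simp add: nbd_le_def factors_through_def)

context category
begin

lemma factors_through_trans:
  assumes fm: "factors_through C f m" and mn: "factors_through C m n" and n: "n \<in> Arr C"
  shows "factors_through C f n"
proof -
  obtain h where h: "h \<in> Hom C (Dom C f) (Dom C m)" "Comp C m h = f"
    using fm by (auto simp: factors_through_def)
  obtain k where k: "k \<in> Hom C (Dom C m) (Dom C n)" "Comp C n k = m"
    using mn by (auto simp: factors_through_def)
  have "Comp C n (Comp C k h) = f"
    using Comp_assoc[OF h(1) k(1) Arr_in_Hom[OF n]] h(2) k(2) by simp
  then show ?thesis
    using Comp_in_Hom[OF h(1) k(1)] by (auto simp: factors_through_def)
qed

text \<open>Given \<open>u\<close> with \<open>p\<close> after \<open>u\<close> equal to
  \<open>a\<close>, commutativity of the square makes \<open>q\<close> after \<open>u\<close> the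
  factor through \<open>g\<close>. Conversely, \<open>a\<close> and a factor \<open>b\<close>
  through \<open>g\<close> form a cone over the cospan, and its mediating morphism is the factor
  through \<open>p\<close>.\<close>

lemma factors_through_pullback_iff:
  assumes pb: "is_pullback C f g p q" and f: "f \<in> Arr C" and g: "g \<in> Arr C"
    and a: "a \<in> Hom C Y (Dom C f)"
  shows "factors_through C a p \<longleftrightarrow> factors_through C (Comp C f a) g"
proof -
  obtain P where p: "p \<in> Hom C P (Dom C f)" and q: "q \<in> Hom C P (Dom C g)"
    and sq: "Comp C f p = Comp C g q"
    and univ: "\<And>Y a b. \<lbrakk>Y \<in> Obj C; a \<in> Hom C Y (Dom C f); b \<in> Hom C Y (Dom C g);
        Comp C f a = Comp C g b\<rbrakk> \<Longrightarrow> \<exists>u. u \<in> Hom C Y P \<and> Comp C p u = a"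
    using pb unfolding is_pullback_def by metis
  have Y: "Y \<in> Obj C"
    using Dom_closed[of a] HomD[OF a] by simp
  have fa: "Dom C (Comp C f a) = Y"
    using Comp_in_Hom[OF a Arr_in_Hom[OF f]] by (rule HomD)
  show ?thesis
  proof
    assume "factors_through C a p"
    then obtain u where u: "u \<in> Hom C Y P" "Comp C p u = a"
      using HomD[OF a] HomD[OF p] by (auto simp: factors_through_def)
    have "Comp C g (Comp C q u) = Comp C f a"
      using Comp_assoc[OF u(1) q Arr_in_Hom[OF g]] Comp_assoc[OF u(1) p Arr_in_Hom[OF f]] sq u(2)
      by simp
    then show "factors_through C (Comp C f a) g"
      using Comp_in_Hom[OF u(1) q] fa by (auto simp: factors_through_def)
  next
    assume "factors_through C (Comp C f a) g"
    then obtain b where "b \<in> Hom C Y (Dom C g)" "Comp C g b = Comp C f a"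
      using fa by (auto simp: factors_through_def)
    then show "factors_through C a p"
      using univ[OF Y a, of b] HomD[OF a] HomD[OF p] by (auto simp: factors_through_def)
  qed
qed

end

lemma forward_invariant_sublevel:
  assumes "cat_functor S C X" and pb: "pullback_choice C pb"
    and D: "lyapunov_measurement_datum C one D"
    and L: "\<And>s. s \<in> Obj S \<Longrightarrow> L s \<in> Hom C (ObjMap X s) (meas_obj D)"
    and decr: "\<And>s t \<alpha>. \<lbrakk>s \<in> Obj S; t \<in> Obj S; \<alpha> \<in> Hom S s t\<rbrakk> \<Longrightarrow>
      (Comp C (L t) (ArrMap X \<alpha>), L s) \<in> meas_le D (ObjMap X s)"
    and l: "l \<in> meas_index D"
  shows "forward_invariant S C X (sublevel S pb D L l)"
  unfolding forward_invariant_def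
proof (intro ballI)
  interpret cat_functor S C X by fact
  fix s t \<alpha>
  assume s: "s \<in> Obj S" and t: "t \<in> Obj S" and \<alpha>: "\<alpha> \<in> Hom S s t"
  define r where "r = meas_mono D l"
  \<comment> \<open>\<open>p s\<close> is the inclusion of the sublevel object into X(s), without
    the restriction to \<open>Obj S\<close> built into \<open>sublevel\<close>; the two agree at
    \<open>s\<close> and \<open>t\<close>.\<close>
  define p where "p s = fst (pb (L s) r)" for s
  have r: "r \<in> Arr C" "Cod C r = meas_obj D"
    using D l by (auto simp: lyapunov_measurement_datum_def monic_def r_def)
  have pb_L: "is_pullback C (L s) r (p s) (snd (pb (L s) r))" if "s \<in> Obj S" for s
    using pb r HomD[OF L[OF that]] by (simp add: pullback_choice_def p_def)
  obtain P where P: "P \<in> Obj C" and p: "p s \<in> Hom C P (ObjMap X s)"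
    using pb_L[OF s] HomD(2)[OF L[OF s]] unfolding is_pullback_def by auto
  have X\<alpha>: "ArrMap X \<alpha> \<in> Hom C (ObjMap X s) (ObjMap X t)"
    using \<alpha> by (rule ArrMap_in_Hom)
  have Xp: "Comp C (ArrMap X \<alpha>) (p s) \<in> Hom C P (ObjMap X t)"
    using p X\<alpha> by (rule C.Comp_in_Hom)
  \<comment> \<open>The pullback criterion is applied to the inclusion itself, which factors through
    itself by the identity of \<open>P\<close>.\<close>
  have "factors_through C (p s) (p s)"
    using C.Id_in_Hom[OF P] C.Comp_Id_right[OF p] HomD(2)[OF p] by (auto simp: factors_through_def)
  then have "factors_through C (Comp C (L s) (p s)) r"
    using C.factors_through_pullback_iff[OF pb_L[OF s], of "p s" P] r(1) p HomD[OF L[OF s]] by simp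
  \<comment> \<open>The decrease condition compares morphisms on X(s); precomposing with
    \<open>p s\<close> moves it to the sublevel object \<open>P\<close>. Reassociating then exposes
    the composite with \<open>L t\<close> that the criterion at \<open>t\<close> expects.\<close>
  moreover have "(Comp C (Comp C (L t) (ArrMap X \<alpha>)) (p s), Comp C (L s) (p s)) \<in> meas_le D P"
    using D decr[OF s t \<alpha>] p P ObjMap_closed[OF s] unfolding lyapunov_measurement_datum_def by blast
  then have "(Comp C (L t) (Comp C (ArrMap X \<alpha>) (p s)), Comp C (L s) (p s)) \<in> meas_le D P"
    using C.Comp_assoc[OF p X\<alpha> L[OF t]] by simp
  ultimately have "factors_through C (Comp C (L t) (Comp C (ArrMap X \<alpha>) (p s))) r"
    using D l P unfolding lyapunov_measurement_datum_def r_def by blast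
  then have "factors_through C (Comp C (ArrMap X \<alpha>) (p s)) (p t)"
    using C.factors_through_pullback_iff[OF pb_L[OF t], of _ P] r(1) Xp HomD[OF L[OF t]] by simp
  then show "factors_through C (Comp C (ArrMap X \<alpha>) (sublevel S pb D L l s)) (sublevel S pb D L l t)"
    using s t by (simp add: sublevel_def p_def r_def)
qed

text \<open>A basis member \<open>\<nu>\<close> below \<open>\<mu>\<close> is the required witness:
  the dynamics carries each \<open>\<nu> s\<close> into \<open>\<nu> t\<close> by forward
  invariance, and \<open>\<nu> t\<close> lies inside \<open>\<mu> t\<close>.\<close>

lemma lyapunov_basis_imp_lyapunov_stable:
  assumes C: "category C" and N: "N \<subseteq> Nbd S C X \<iota>" and B: "lyapunov_basis S C X N B"
  shows "lyapunov_stable S C X N"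
  unfolding lyapunov_stable_def
proof
  fix \<mu> assume \<mu>: "\<mu> \<in> N"
  then obtain \<nu> where \<nu>: "\<nu> \<in> B" "nbd_le S C \<nu> \<mu>" "\<nu> \<in> N"
    using B unfolding lyapunov_basis_def nbd_basis_def by blast
  have arr: "\<mu> t \<in> Arr C" if "t \<in> Obj S" for t
    using N \<mu> that by (auto simp: Nbd_def monic_def)
  have "factors_through C (Comp C (ArrMap X \<alpha>) (\<nu> s)) (\<mu> t)"
    if "s \<in> Obj S" "t \<in> Obj S" "\<alpha> \<in> Hom S s t" for s t \<alpha>
  proof (rule category.factors_through_trans[OF C])
    show "factors_through C (Comp C (ArrMap X \<alpha>) (\<nu> s)) (\<nu> t)"
      using B \<nu>(1) that by (auto simp: lyapunov_basis_def forward_invariant_def)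
    show "factors_through C (\<nu> t) (\<mu> t)"
      using \<nu>(2) that by (simp add: nbd_le_iff_factors_through)
  qed (use arr that in blast)
  with \<nu> show "\<exists>\<nu>\<in>N. nbd_le S C \<nu> \<mu> \<and>
      (\<forall>s\<in>Obj S. \<forall>t\<in>Obj S. \<forall>\<alpha>\<in>Hom S s t.
        factors_through C (Comp C (ArrMap X \<alpha>) (\<nu> s)) (\<mu> t))"
    by blast
qed

theorem theorem4p9:
  fixes S :: "('s, 'b) cat" and C :: "('o, 'a) cat"
    and one :: 'o and pb :: "'a \<Rightarrow> 'a \<Rightarrow> 'a \<times> 'a"
    and X :: "('s, 'b, 'o, 'a) functor_data"
    and I :: 'o and \<iota> :: "'s \<Rightarrow> 'a" and N :: "('s \<Rightarrow> 'a) set"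
    and D :: "('o, 'a, 'l) measurement_datum" and L :: "'s \<Rightarrow> 'a"
  assumes "category S" and "category C"
    and "terminal C one" and "pullback_choice C pb"
    and "cat_functor S C X"
    and "invariant_subsystem S C X I \<iota>"
    and "neighbourhood_filter S C X \<iota> N"
    and "lyapunov_function S C one pb X I \<iota> N D L"
  shows "lyapunov_basis S C X N (sublevel S pb D L ` meas_index D)
    \<and> lyapunov_stable S C X N"
proof -
  \<comment> \<open>That the sublevel family is a basis is clause (3) of a Lyapunov function, so
    what remains for a Lyapunov basis is forward invariance of each member.\<close>
  have "forward_invariant S C X (sublevel S pb D L l)" if "l \<in> meas_index D" for l
    using assms(4,5,8) that
    by (intro forward_invariant_sublevel) (auto simp: lyapunov_function_def)
  then have basis: "lyapunov_basis S C X N (sublevel S pb D L ` meas_index D)"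
    using assms(8) by (auto simp: lyapunov_basis_def lyapunov_function_def)
  have "N \<subseteq> Nbd S C X \<iota>"
    using assms(7) by (simp add: neighbourhood_filter_def)
  with basis show ?thesis
    using lyapunov_basis_imp_lyapunov_stable[OF assms(2)] by blast
qed

end
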